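(* Let $q\ge 0$ be an integer, let $x_0,\dots,x_q\in\mathbb{C}$ and let $\tau\in\mathbb{R}$. Then $$\sum_{\substack{i,j=0\\ i\le j}}^q x_i\,e^{-\tau[x_0,\dots,x_q,x_i,x_j]}=\left(-\frac{\tau^2}{2}\frac{\partial}{\partial\tau}-\sum_{i=0}^q i\cdot\frac{\partial}{\partial x_i}\right)e^{-\tau[x_0,\dots,x_q]}.$$
   Context: For a number $t$ and nodes $z_0,\dots,z_m\in\mathbb{C}$, $e^{t[z_0,\dots,z_m]}$ denotes the divided difference $f[z_0,\dots,z_m]$ of the function $f(x)=e^{tx}$ at the nodes $z_0,\dots,z_m$ (not the exponential of a divided difference). Here, for holomorphic $f$, $f[z_0,\dots,z_m]=\frac{1}{2\pi i}\oint_\Gamma\frac{f(z)}{\prod_{i=0}^m(z-z_i)}\,dz$ with $\Gamma$ a positively oriented contour enclosing all the $z_i$; for pairwise distinct nodes this equals $\sum_{i=0}^m f(z_i)/\prod_{k\ne i}(z_i-z_k)$. Nodes may be repeated; $[x_0,\dots,x_q,x_i,x_j]$ is the list $x_0,\dots,x_q$ with $x_i$ and $x_j$ appended. In the factor $i\cdot\partial/\partial x_i$, $i$ is the integer summation index, and $\partial/\partial x_i$ is the partial derivative in the node $x_i$ of $e^{-\tau[x_0,\dots,x_q]}$ viewed as a function of $(\tau,x_0,\dots,x_q)$. *)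

theory Defs
  imports "HOL-Complex_Analysis.Complex_Analysis"
begin

text \<open>
  Divided difference \<open>f[z\<^sub>0,\<dots>,z\<^sub>m]\<close> of an entire function \<open>f\<close> at the list \<open>zs\<close> of (possibly
  repeated) nodes.  The contour is a concrete circle about the origin enclosing all the nodes;
  lemma \<open>divdiff_eq_contour_integral\<close> shows that any other contour gives the same value.
\<close>

definition divdiff :: "(complex \<Rightarrow> complex) \<Rightarrow> complex list \<Rightarrow> complex" where
  "divdiff f zs =
     1 / (2 * of_real pi * \<i>) *
     contour_integral (circlepath 0 (1 + (\<Sum>w\<leftarrow>zs. cmod w)))
       (\<lambda>z. f z / (\<Prod>w\<leftarrow>zs. z - w))"

definition exp_divdiff :: "complex \<Rightarrow> complex list \<Rightarrow> complex" where
  "exp_divdiff t zs = divdiff (\<lambda>z. exp (t * z)) zs"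

lemma norm_node_less_radius:
  assumes "w \<in> set zs"
  shows "cmod w < 1 + (\<Sum>w\<leftarrow>zs. cmod w)"
proof -
  have "cmod w \<le> (\<Sum>w\<leftarrow>zs. cmod w)"
    using assms by (intro member_le_sum_list) auto
  then show ?thesis by simp
qed

lemma contour_integral_divdiff_residues:
  assumes f: "f holomorphic_on UNIV"
    and g: "valid_path g" "pathfinish g = pathstart g" "path_image g \<inter> set zs = {}"
    and wn: "\<And>w. w \<in> set zs \<Longrightarrow> winding_number g w = 1"
  shows "contour_integral g (\<lambda>z. f z / (\<Prod>w\<leftarrow>zs. z - w)) =
    2 * of_real pi * \<i> * (\<Sum>p\<in>set zs. residue (\<lambda>z. f z / (\<Prod>w\<leftarrow>zs. z - w)) p)"
proof -
  have hol: "(\<lambda>z. f z / (\<Prod>w\<leftarrow>zs. z - w)) holomorphic_on UNIV - set zs"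
  proof (intro holomorphic_on_divide)
    show "f holomorphic_on UNIV - set zs"
      using f by (rule holomorphic_on_subset) auto
    have "(\<lambda>z. \<Prod>w\<leftarrow>ws. z - w) holomorphic_on A" for ws :: "complex list" and A
      by (induction ws) (auto intro!: holomorphic_intros)
    then show "(\<lambda>z. \<Prod>w\<leftarrow>zs. z - w) holomorphic_on UNIV - set zs" .
  qed (auto simp: prod_list_zero_iff)
  have "contour_integral g (\<lambda>z. f z / (\<Prod>w\<leftarrow>zs. z - w)) = 2 * of_real pi * \<i> *
      (\<Sum>p\<in>set zs. winding_number g p * residue (\<lambda>z. f z / (\<Prod>w\<leftarrow>zs. z - w)) p)"
    using Residue_theorem[OF open_UNIV connected_UNIV _ hol g(1,2)] g(3) by auto
  then show ?thesis using wn by simp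
qed

lemma divdiff_eq_contour_integral:
  assumes "f holomorphic_on UNIV"
    and "valid_path g" "pathfinish g = pathstart g" "path_image g \<inter> set zs = {}"
    and "\<And>w. w \<in> set zs \<Longrightarrow> winding_number g w = 1"
  shows "divdiff f zs =
    1 / (2 * of_real pi * \<i>) * contour_integral g (\<lambda>z. f z / (\<Prod>w\<leftarrow>zs. z - w))"
proof -
  let ?r = "1 + (\<Sum>w\<leftarrow>zs. cmod w)"
  have r: "?r > 0" by (intro add_pos_nonneg sum_list_nonneg) auto
  have "path_image (circlepath 0 ?r) \<inter> set zs = {}"
    using r norm_node_less_radius[of _ zs] by (fastforce simp: dist_norm)
  moreover have "winding_number (circlepath 0 ?r) w = 1" if "w \<in> set zs" for w
    using norm_node_less_radius[OF that] by (intro winding_number_circlepath) auto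
  ultimately show ?thesis
    unfolding divdiff_def
    using contour_integral_divdiff_residues[OF assms(1), of "circlepath 0 ?r" zs]
      contour_integral_divdiff_residues[OF assms]
    by simp
qed

end

theory Submission
  imports Defs
begin

text \<open>
  Write every divided difference as an integral over one circle enclosing all nodes, put
  \<open>Q(z) = 1 / \<Prod>\<^sub>k (z - x\<^sub>k)\<close> and \<open>E(z) = exp (-\<tau> z)\<close>. Differentiating under the integral in \<open>x\<^sub>i\<close>
  multiplies the integrand \<open>E Q\<close> by \<open>1 / (z - x\<^sub>i)\<close>, differentiating in \<open>\<tau>\<close> multiplies it by \<open>-z\<close>.
  From \<open>x\<^sub>i / (z - x\<^sub>i) = z / (z - x\<^sub>i) - 1\<close> and the fact that \<open>Q''\<close> is \<open>2 Q\<close> times the complete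
  homogeneous sum of degree 2 in the \<open>1 / (z - x\<^sub>k)\<close>, the integrands of the two sides differ by
  \<open>(z E Q'') / 2 + E Q' - \<tau>\<^sup>2 z E Q / 2\<close>, which is the derivative of
  \<open>E (z Q' + (1 + \<tau> z) Q) / 2\<close> and hence integrates to zero.
\<close>

lemma continuous_on_circle_over_prod:
  fixes zs :: "complex list"
  assumes R: "\<And>w. w \<in> set zs \<Longrightarrow> cmod w < R" and f: "continuous_on UNIV f"
  shows "continuous_on (path_image (circlepath 0 R)) (\<lambda>z. f z / (\<Prod>w\<leftarrow>zs. z - w))"
proof (intro continuous_intros)
  show "continuous_on (path_image (circlepath 0 R)) f"
    using f by (rule continuous_on_subset) auto
  have "continuous_on A (\<lambda>z. \<Prod>w\<leftarrow>ws. z - w)" for ws :: "complex list" and A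
    by (induction ws) (auto intro!: continuous_intros)
  then show "continuous_on (path_image (circlepath 0 R)) (\<lambda>z. \<Prod>w\<leftarrow>zs. z - w)" .
  show "\<forall>z\<in>path_image (circlepath 0 R). (\<Prod>w\<leftarrow>zs. z - w) \<noteq> 0"
    using R by (fastforce simp: prod_list_zero_iff path_image_circlepath_minus dist_norm)
qed

text \<open>The radius in \<open>divdiff\<close> changes with the node list. By independence of the
  contour any larger centred circle serves as well, so lists with extra nodes can be compared on one
  circle, and the \<open>has_contour_integral\<close> form lets them be combined linearly.\<close>

lemma exp_divdiff_has_contour_integral:
  assumes R: "\<And>w. w \<in> set zs \<Longrightarrow> cmod w < R"
  shows "((\<lambda>z. exp (t * z) / (\<Prod>w\<leftarrow>zs. z - w)) has_contour_integral
           2 * of_real pi * \<i> * exp_divdiff t zs) (circlepath 0 R)"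
proof -
  have "(\<lambda>z. exp (t * z) / (\<Prod>w\<leftarrow>zs. z - w)) contour_integrable_on circlepath 0 R"
    by (intro contour_integrable_continuous_circlepath continuous_on_circle_over_prod
        continuous_intros R)
  moreover have "path_image (circlepath 0 R) \<inter> set zs = {}"
    using R by (fastforce simp: path_image_circlepath_minus dist_norm)
  moreover have "winding_number (circlepath 0 R) w = 1" if "w \<in> set zs" for w
    using R[OF that] by (intro winding_number_circlepath) auto
  moreover have "(\<lambda>z. exp (t * z)) holomorphic_on UNIV"
    by (intro holomorphic_intros)
  ultimately show ?thesis
    using divdiff_eq_contour_integral[of "\<lambda>z. exp (t * z)" "circlepath 0 R" zs]
    by (simp add: exp_divdiff_def has_contour_integral_integral)
qed

text \<open>As a function of one node \<open>v\<close> the divided difference is a Cauchy-type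
  integral with kernel \<open>1 / (u - v)\<close>. Its derivative has kernel
  \<open>1 / (u - v)^2\<close>, which is the same as listing the node twice.\<close>

lemma has_field_derivative_exp_divdiff_node:
  "((\<lambda>z. exp_divdiff t (as @ z # bs)) has_field_derivative exp_divdiff t (as @ z # z # bs)) (at z)"
proof -
  define R where "R = 1 + (\<Sum>w\<leftarrow>as @ z # bs. cmod w)"
  have R: "cmod w < R" if "w \<in> set (as @ z # bs)" for w
    using norm_node_less_radius[OF that] by (simp add: R_def)
  \<comment> \<open>All factors free of the moving node. \<open>f\<close> may have poles inside the
    disc, but differentiating a Cauchy-type integral only asks for continuity on the circle.\<close>
  define f where "f = (\<lambda>u. exp (t * u) / (\<Prod>w\<leftarrow>as @ bs. u - w))"
  have int: "((\<lambda>u. f u / (u - v) ^ 1) has_contour_integral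
               2 * of_real pi * \<i> * exp_divdiff t (as @ v # bs)) (circlepath 0 R)"
    if "v \<in> ball 0 R" for v
  proof -
    have "cmod w < R" if "w \<in> set (as @ v # bs)" for w
      using that R \<open>v \<in> ball 0 R\<close> by auto
    from exp_divdiff_has_contour_integral[of "as @ v # bs" R t, OF this] show ?thesis
      by (simp add: f_def mult_ac)
  qed
  have cont: "continuous_on (path_image (circlepath 0 R)) f"
    unfolding f_def using R
    by (intro continuous_on_circle_over_prod continuous_intros) auto
  have "((\<lambda>v. 2 * of_real pi * \<i> * exp_divdiff t (as @ v # bs)) has_field_derivative
          of_nat 1 * contour_integral (circlepath 0 R) (\<lambda>u. f u / (u - z) ^ Suc 1)) (at z)"
    using R by (intro Cauchy_next_derivative_circlepath(2)[OF cont int]) auto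
  moreover have "contour_integral (circlepath 0 R) (\<lambda>u. f u / (u - z) ^ Suc 1) =
      2 * of_real pi * \<i> * exp_divdiff t (as @ z # z # bs)"
    using exp_divdiff_has_contour_integral[of "as @ z # z # bs" R t] R
    by (intro contour_integral_unique) (simp add: f_def mult_ac)
  ultimately have "((\<lambda>v. 2 * of_real pi * \<i> * exp_divdiff t (as @ v # bs)) has_field_derivative
      2 * of_real pi * \<i> * exp_divdiff t (as @ z # z # bs)) (at z)"
    by simp
  from DERIV_cdivide[OF this, of "2 * of_real pi * \<i>"] show ?thesis by simp
qed

text \<open>Pulled back to the parameter interval, the integral depends on \<open>t\<close> only
  through the factor \<open>exp (t * z)\<close>, so the Leibniz rule on a compact interval
  applies.\<close>

lemma has_field_derivative_exp_divdiff_time: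
  assumes R: "\<And>w. w \<in> set zs \<Longrightarrow> cmod w < R"
  shows "((\<lambda>t. exp_divdiff t zs) has_field_derivative
           1 / (2 * of_real pi * \<i>) *
           contour_integral (circlepath 0 R) (\<lambda>z. z * exp (t * z) / (\<Prod>w\<leftarrow>zs. z - w))) (at t)"
proof -
  define \<gamma> where "\<gamma> = circlepath 0 R"
  \<comment> \<open>The weight independent of \<open>t\<close>: the speed of the path over the node
    product.\<close>
  define k where "k = (\<lambda>\<theta>. vector_derivative \<gamma> (at \<theta>) / (\<Prod>w\<leftarrow>zs. \<gamma> \<theta> - w))"
  have \<gamma>: "continuous_on A \<gamma>" for A
    unfolding \<gamma>_def circlepath by (intro continuous_intros)
  have \<gamma>': "continuous_on {0..1} (\<lambda>\<theta>. vector_derivative \<gamma> (at \<theta>))"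
    unfolding \<gamma>_def vector_derivative_circlepath by (intro continuous_intros)
  have "continuous_on {0..1} (\<lambda>\<theta>. 1 / (\<Prod>w\<leftarrow>zs. \<gamma> \<theta> - w))"
    by (rule continuous_on_compose2[OF continuous_on_circle_over_prod[OF R, where f = "\<lambda>_. 1"] \<gamma>])
       (auto simp: \<gamma>_def path_image_def)
  from continuous_on_mult[OF \<gamma>' this] have k: "continuous_on {0..1} k"
    by (simp add: k_def)
  have k2: "continuous_on (UNIV \<times> {0..1}) (\<lambda>p. k (snd p))"
    by (rule continuous_on_compose2[OF k]) (auto intro!: continuous_intros)
  have \<gamma>2: "continuous_on (UNIV \<times> {0..1}) (\<lambda>p :: complex \<times> real. \<gamma> (snd p))"
    by (rule continuous_on_compose2[OF \<gamma>[of UNIV]]) (auto intro!: continuous_intros)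
  have "((\<lambda>t. integral (cbox 0 1) (\<lambda>\<theta>. exp (t * \<gamma> \<theta>) * k \<theta>)) has_field_derivative
          integral (cbox 0 1) (\<lambda>\<theta>. \<gamma> \<theta> * exp (t * \<gamma> \<theta>) * k \<theta>)) (at t)"
  proof (rule leibniz_rule_field_derivative)
    show "((\<lambda>t. exp (t * \<gamma> \<theta>) * k \<theta>) has_field_derivative \<gamma> \<theta> * exp (s * \<gamma> \<theta>) * k \<theta>) (at s)"
      for s \<theta>
      by (auto intro!: derivative_eq_intros)
    show "(\<lambda>\<theta>. exp (s * \<gamma> \<theta>) * k \<theta>) integrable_on cbox 0 1" for s
      using k by (intro integrable_continuous continuous_intros \<gamma>) auto
    show "continuous_on (UNIV \<times> cbox 0 1) (\<lambda>(s, \<theta>). \<gamma> \<theta> * exp (s * \<gamma> \<theta>) * k \<theta>)"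
      using k2 \<gamma>2 by (auto simp: case_prod_beta intro!: continuous_intros)
  qed auto
  then have "((\<lambda>t. contour_integral \<gamma> (\<lambda>z. exp (t * z) / (\<Prod>w\<leftarrow>zs. z - w))) has_field_derivative
          contour_integral \<gamma> (\<lambda>z. z * exp (t * z) / (\<Prod>w\<leftarrow>zs. z - w))) (at t)"
    by (simp add: contour_integral_integral k_def mult_ac)
  from DERIV_cmult[OF this, of "1 / (2 * of_real pi * \<i>)"]
  show ?thesis
    by (simp add: contour_integral_unique[OF exp_divdiff_has_contour_integral[OF R]] \<gamma>_def)
qed

text \<open>Doubling the triangle \<open>i \<le> j\<close> covers the full square with the diagonal
  counted once too often. This turns the complete homogeneous sum of degree 2 into power
  sums.\<close>

lemma sum_triangle_mult:
  fixes u :: "nat \<Rightarrow> 'a::comm_ring_1"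
  shows "2 * (\<Sum>j\<le>q. \<Sum>i\<le>j. u i * u j) = (\<Sum>i\<le>q. u i)\<^sup>2 + (\<Sum>i\<le>q. (u i)\<^sup>2)"
proof (induction q)
  case (Suc q)
  have "(\<Sum>i\<le>q. u i * u (Suc q)) = (\<Sum>i\<le>q. u i) * u (Suc q)"
    by (simp add: sum_distrib_right)
  with Suc show ?case
    by (simp add: algebra_simps power2_eq_square)
qed (simp add: power2_eq_square)

text \<open>Logarithmic derivative: each factor \<open>1 / (z - x k)\<close> contributes
  \<open>- 1 / (z - x k)\<close>.\<close>

lemma has_field_derivative_inverse_node_prod:
  fixes x :: "nat \<Rightarrow> 'a::real_normed_field"
  assumes "\<And>k. k \<le> q \<Longrightarrow> z \<noteq> x k"
  shows "((\<lambda>z. inverse (\<Prod>k\<le>q. z - x k)) has_field_derivative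
           - (\<Sum>k\<le>q. inverse (z - x k)) * inverse (\<Prod>k\<le>q. z - x k)) (at z)"
  using assms
proof (induction q)
  case 0
  then show ?case by (auto intro!: derivative_eq_intros simp: power2_eq_square)
next
  case (Suc q)
  have "((\<lambda>z. inverse (z - x (Suc q))) has_field_derivative
      - (inverse (z - x (Suc q)) * inverse (z - x (Suc q)))) (at z)"
    using Suc.prems[of "Suc q"] by (auto intro!: derivative_eq_intros)
  from DERIV_mult[OF Suc.IH this] Suc.prems show ?case
    by (simp add: distrib_left distrib_right mult_ac) (simp add: right_diff_distrib mult_ac)
qed

theorem theorem8:
  fixes q :: nat and x :: "nat \<Rightarrow> complex" and \<tau> :: real
  shows "(\<Sum>(i, j) \<in> {(i, j). i \<le> j \<and> j \<le> q}.
            x i * exp_divdiff (- of_real \<tau>) (map x [0..<Suc q] @ [x i, x j]))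
       = - (of_real (\<tau>\<^sup>2) / 2) *
           vector_derivative (\<lambda>s::real. exp_divdiff (- of_real s) (map x [0..<Suc q])) (at \<tau>)
         - (\<Sum>i = 0..q. of_nat i *
             deriv (\<lambda>z. exp_divdiff (- of_real \<tau>) (map (x(i := z)) [0..<Suc q])) (x i))"
proof -
  define t where "t = complex_of_real \<tau>"
  define xs where "xs = map x [0..<Suc q]"
  \<comment> \<open>The appended nodes \<open>x i\<close>, \<open>x j\<close> already occur in
    \<open>xs\<close>, so this one circle encloses every node list below.\<close>
  define R where "R = 1 + (\<Sum>w\<leftarrow>xs. cmod w)"
  define c where "c = 2 * of_real pi * \<i>"
  define E where "E = (\<lambda>z. exp (- t * z))"
  define Q where "Q = (\<lambda>z. inverse (\<Prod>k\<le>q. z - x k))"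
  define u where "u = (\<lambda>i z. inverse (z - x i))"
  define S where "S = (\<lambda>z. \<Sum>i\<le>q. u i z)"
  define I where "I = contour_integral (circlepath 0 R) (\<lambda>z. z * E z * Q z)"
  have R: "cmod w < R" if "w \<in> set xs" for w
    using norm_node_less_radius[OF that] by (simp add: R_def)
  have Rx: "cmod (x i) < R" if "i \<le> q" for i
    using that by (intro R) (auto simp: xs_def simp del: upt_Suc)
  have c0: "c \<noteq> 0" by (simp add: c_def)
  have off: "z \<noteq> x i" if "z \<in> path_image (circlepath 0 R)" "i \<le> q" for z i
    using that Rx[OF that(2)] by (auto simp: path_image_circlepath_minus dist_norm)
  have P: "(\<Prod>w\<leftarrow>xs. z - w) = (\<Prod>k\<le>q. z - x k)" for z
    unfolding xs_def
    by (induction q) (auto simp: prod.atMost_Suc)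
  have "((\<lambda>s::real. exp_divdiff (- of_real s) xs) has_vector_derivative
          - 1 * (1 / c * contour_integral (circlepath 0 R)
                    (\<lambda>z. z * exp (- t * z) / (\<Prod>w\<leftarrow>xs. z - w)))) (at \<tau>)"
  proof (rule field_vector_diff_chain_at[where f = "\<lambda>s. - of_real s", unfolded o_def])
    show "((\<lambda>s. - complex_of_real s) has_vector_derivative - 1) (at \<tau>)"
      by (auto intro!: derivative_eq_intros)
  qed (use has_field_derivative_exp_divdiff_time[of xs R "- t", OF R] in
      \<open>simp add: c_def t_def\<close>)
  then have time: "vector_derivative (\<lambda>s::real. exp_divdiff (- of_real s) xs) (at \<tau>) = - (I / c)"
    by (intro vector_derivative_at) (simp add: I_def E_def Q_def P divide_inverse mult_ac)
  have node: "deriv (\<lambda>z. exp_divdiff (- t) (map (x(i := z)) [0..<Suc q])) (x i)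
                = exp_divdiff (- t) (xs @ [x i])" if "i \<le> q" for i
  proof -
    \<comment> \<open>Isolates position \<open>i\<close>, so that updating \<open>x\<close> at
      \<open>i\<close> changes exactly one list entry, even if the values of \<open>x\<close>
      repeat.\<close>
    have split: "[0..<Suc q] = [0..<i] @ i # [Suc i..<Suc q]"
      using that by (metis le_imp_less_Suc upt_conv_Cons upt_add_eq_append le_add_diff_inverse
          less_imp_le_nat zero_le)
    have upd: "map (x(i := z)) [0..<Suc q] = map x [0..<i] @ z # map x [Suc i..<Suc q]" for z
      unfolding split by auto
    have "deriv (\<lambda>z. exp_divdiff (- t) (map (x(i := z)) [0..<Suc q])) (x i)
        = exp_divdiff (- t) (map x [0..<i] @ x i # x i # map x [Suc i..<Suc q])"
      unfolding upd by (intro DERIV_imp_deriv has_field_derivative_exp_divdiff_node)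
    \<comment> \<open>\<open>divdiff\<close> sees its nodes only through a sum and a product, hence
      is symmetric; the doubled node may move to the end.\<close>
    also have "\<dots> = exp_divdiff (- t) (xs @ [x i])"
      unfolding xs_def split by (simp add: exp_divdiff_def divdiff_def mult_ac add_ac)
    finally show ?thesis .
  qed
  have one: "((\<lambda>z. E z * Q z * u i z) has_contour_integral c * exp_divdiff (- t) (xs @ [x i]))
      (circlepath 0 R)" if "i \<le> q" for i
    using exp_divdiff_has_contour_integral[of "xs @ [x i]" R "- t"] R Rx[OF that]
    by (auto simp: P E_def Q_def u_def c_def divide_inverse mult_ac)
  have two: "((\<lambda>z. E z * Q z * u i z * u j z) has_contour_integral
      c * exp_divdiff (- t) (xs @ [x i, x j])) (circlepath 0 R)" if "i \<le> q" "j \<le> q" for i j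
    using exp_divdiff_has_contour_integral[of "xs @ [x i, x j]" R "- t"] R Rx[OF that(1)] Rx[OF that(2)]
    by (auto simp: P E_def Q_def u_def c_def divide_inverse mult_ac)
  have zero: "((\<lambda>z. z * E z * Q z) has_contour_integral I) (circlepath 0 R)"
    unfolding I_def
  proof (intro has_contour_integral_integral contour_integrable_continuous_circlepath)
    have "continuous_on UNIV (\<lambda>z. z * E z)"
      unfolding E_def by (intro continuous_intros)
    from continuous_on_circle_over_prod[of xs R, OF R this]
    show "continuous_on (path_image (circlepath 0 R)) (\<lambda>z. z * E z * Q z)"
      by (simp add: P Q_def divide_inverse)
  qed
  \<comment> \<open>The difference of the two integrands, with \<open>Q' = - S Q\<close> and
    \<open>Q'' = (S^2 + T) Q\<close> inserted, where \<open>T\<close> is the sum of the squares of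
    the \<open>u i\<close>. In the derivative of the primitive below, the terms linear in
    \<open>t\<close> cancel.\<close>
  define G' where "G' = (\<lambda>z. E z * Q z * (z * (\<Sum>j\<le>q. \<Sum>i\<le>j. u i z * u j z) - S z - t\<^sup>2 * z / 2))"
  have prim: "(G' has_contour_integral 0) (circlepath 0 R)"
  proof (rule Cauchy_theorem_primitive)
    show "((\<lambda>z. E z * (1 + t * z - z * S z) * Q z / 2) has_field_derivative G' z)
        (at z within path_image (circlepath 0 R))" if z: "z \<in> path_image (circlepath 0 R)" for z
    proof -
      note off = off[OF z]
      define T where "T = (\<Sum>i\<le>q. (u i z)\<^sup>2)"
      have Q: "(Q has_field_derivative - S z * Q z) (at z)"
        unfolding Q_def S_def u_def by (rule has_field_derivative_inverse_node_prod) (rule off)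
      have S: "(S has_field_derivative - T) (at z)"
        unfolding S_def u_def T_def using off
        by (auto intro!: derivative_eq_intros simp: power2_eq_square sum_negf)
      have E: "(E has_field_derivative - t * E z) (at z)"
        unfolding E_def by (auto intro!: derivative_eq_intros)
      have h2: "(\<Sum>j\<le>q. \<Sum>i\<le>j. u i z * u j z) = ((S z)\<^sup>2 + T) / 2"
        unfolding S_def T_def sum_triangle_mult[symmetric] by simp
      have "((\<lambda>z. E z * (1 + t * z - z * S z) * Q z / 2) has_field_derivative G' z) (at z)"
        unfolding G'_def h2
        by (rule Q S E derivative_eq_intros refl)+ (simp_all add: ring_distribs power2_eq_square)
      then show ?thesis by (rule has_field_derivative_at_within)
    qed
  qed auto
  have tri: "(\<Sum>(i, j) \<in> {(i, j). i \<le> j \<and> j \<le> q}. f i j) = (\<Sum>j\<le>q. \<Sum>i\<le>j. f i j)"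
    for f :: "nat \<Rightarrow> nat \<Rightarrow> complex"
    by (subst sum.Sigma, simp, simp,
        rule sum.reindex_bij_witness[of _ "\<lambda>(j, i). (i, j)" "\<lambda>(i, j). (j, i)"]) auto
  define L where "L = (\<Sum>j\<le>q. \<Sum>i\<le>j. x i * (c * exp_divdiff (- t) (xs @ [x i, x j])))"
  define N where "N = (\<Sum>i\<le>q. of_nat i * (c * exp_divdiff (- t) (xs @ [x i])))"
  have lhs: "((\<lambda>z. \<Sum>j\<le>q. \<Sum>i\<le>j. x i * (E z * Q z * u i z * u j z)) has_contour_integral L)
      (circlepath 0 R)"
    unfolding L_def by (intro has_contour_integral_sum has_contour_integral_lmul two) auto
  \<comment> \<open>The same integrand is evaluated a second time; uniqueness of the integral then
    gives the identity.\<close>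
  have rhs: "((\<lambda>z. \<Sum>j\<le>q. \<Sum>i\<le>j. x i * (E z * Q z * u i z * u j z)) has_contour_integral
      (t\<^sup>2 / 2 * I - N + 0)) (circlepath 0 R)"
  proof (rule has_contour_integral_eq)
    show "((\<lambda>z. t\<^sup>2 / 2 * (z * E z * Q z) - (\<Sum>i\<le>q. of_nat i * (E z * Q z * u i z)) + G' z)
        has_contour_integral (t\<^sup>2 / 2 * I - N + 0)) (circlepath 0 R)"
      unfolding N_def
      by (intro has_contour_integral_add has_contour_integral_diff has_contour_integral_sum
          has_contour_integral_lmul zero one prim) auto
    fix z assume z: "z \<in> path_image (circlepath 0 R)"
    have xu: "x i * u i z = z * u i z - 1" if "i \<le> q" for i
      using off[OF z that] by (simp add: u_def field_simps)
    have "(\<Sum>j\<le>q. \<Sum>i\<le>j. x i * (E z * Q z * u i z * u j z))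
        = (\<Sum>j\<le>q. \<Sum>i\<le>j. E z * Q z * (z * (u i z * u j z) - u j z))"
    proof (intro sum.cong refl)
      fix i j assume "j \<in> {..q}" "i \<in> {..j}"
      then have "x i * u i z = z * u i z - 1" by (intro xu) auto
      then show "x i * (E z * Q z * u i z * u j z) = E z * Q z * (z * (u i z * u j z) - u j z)"
        by algebra
    qed
    \<comment> \<open>\<open>u j\<close> is subtracted once for each \<open>i \<le> j\<close>, that
      is \<open>j + 1\<close> times. Of these, \<open>j\<close> copies give the weight of the node
      derivative, and the remaining one adds up to the \<open>S\<close> inside
      \<open>G'\<close>.\<close>
    also have "\<dots> = E z * Q z * (z * (\<Sum>j\<le>q. \<Sum>i\<le>j. u i z * u j z) - (\<Sum>j\<le>q. of_nat (Suc j) * u j z))"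
      by (simp add: sum_distrib_left sum_subtractf right_diff_distrib mult_ac)
    also have "(\<Sum>j\<le>q. of_nat (Suc j) * u j z) = S z + (\<Sum>j\<le>q. of_nat j * u j z)"
      by (simp add: S_def algebra_simps sum.distrib)
    finally show "t\<^sup>2 / 2 * (z * E z * Q z) - (\<Sum>i\<le>q. of_nat i * (E z * Q z * u i z)) + G' z
        = (\<Sum>j\<le>q. \<Sum>i\<le>j. x i * (E z * Q z * u i z * u j z))"
      by (simp add: G'_def algebra_simps sum_distrib_left)
  qed
  from has_contour_integral_unique[OF lhs rhs] have "L = t\<^sup>2 / 2 * I - N"
    by simp
  moreover have "L = c * (\<Sum>(i, j) \<in> {(i, j). i \<le> j \<and> j \<le> q}.
      x i * exp_divdiff (- t) (xs @ [x i, x j]))"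
    by (simp add: L_def tri sum_distrib_left mult_ac)
  moreover have "N = c * (\<Sum>i = 0..q. of_nat i *
      deriv (\<lambda>z. exp_divdiff (- t) (map (x(i := z)) [0..<Suc q])) (x i))"
    unfolding N_def sum_distrib_left atLeast0AtMost
    by (intro sum.cong refl) (simp add: node mult_ac del: upt_Suc)
  \<comment> \<open>The factor \<open>- (I / c)\<close> is kept unsimplified because it is the time
    derivative from \<open>time\<close>.\<close>
  ultimately have "c * (\<Sum>(i, j) \<in> {(i, j). i \<le> j \<and> j \<le> q}.
      x i * exp_divdiff (- t) (xs @ [x i, x j]))
    = c * (- (t\<^sup>2 / 2) * - (I / c) - (\<Sum>i = 0..q. of_nat i *
      deriv (\<lambda>z. exp_divdiff (- t) (map (x(i := z)) [0..<Suc q])) (x i)))"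
    using c0 by (simp add: right_diff_distrib del: upt_Suc)
  then show ?thesis
    unfolding xs_def[symmetric] time t_def[symmetric] of_real_power using c0
    by (simp only: mult_cancel_left simp_thms)
qed

end
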